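(* For each pair of integers $a$ and $b$ with $a\geq 2$ and $a+1\leq b\leq 2a$, there exists a tree $T$ such that $\rho^{0}(T)=L_1(T)=a$ and $L_2(T)=b$.
   Context: All graphs are finite, undirected and simple. $N(v)$ is the open neighbourhood of $v$ and $N[v]=\{v\}\cup N(v)$ the closed neighbourhood. An open packing of $G$ is a set $S\subseteq V(G)$ with $|N(v)\cap S|\le 1$ for every vertex $v$ of $G$; the open packing number $\rho^0(G)$ is the maximum cardinality of an open packing. For an integer $k\ge 1$, a set $B\subseteq V(G)$ is a $k$-limited packing if $|N[v]\cap B|\le k$ for every vertex $v$ of $G$; $L_k(G)$ is the maximum cardinality of a $k$-limited packing in $G$. *)

theory Defs
  imports "Graph_Theory.Digraph_Component"
begin

text \<open>
  Finite simple graphs are the library's \<^locale>\<open>graph\<close>: finite, symmetric, loop-free digraphs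
  without parallel arcs, so that an undirected edge is a pair of opposite arcs.
  For that reason the library's \<open>forest\<close> and \<open>tree\<close> do not describe undirected trees: traversing an
  edge back and forth already is a \<open>cycle\<close> (of length 2). In a simple graph the undirected cycles
  are exactly the cycles of length at least 3.
\<close>

definition undirected_tree :: "('a, 'b) pre_digraph \<Rightarrow> bool" where
  "undirected_tree G \<longleftrightarrow>
     graph G \<and> connected G \<and> \<not> (\<exists>p. pre_digraph.cycle G p \<and> 3 \<le> length p)"

definition open_nbhd :: "('a, 'b) pre_digraph \<Rightarrow> 'a \<Rightarrow> 'a set" where
  "open_nbhd G v = {w \<in> verts G. v \<rightarrow>\<^bsub>G\<^esub> w}"

definition closed_nbhd :: "('a, 'b) pre_digraph \<Rightarrow> 'a \<Rightarrow> 'a set" where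
  "closed_nbhd G v = {v} \<union> open_nbhd G v"

definition open_packing :: "('a, 'b) pre_digraph \<Rightarrow> 'a set \<Rightarrow> bool" where
  "open_packing G S \<longleftrightarrow>
     S \<subseteq> verts G \<and> (\<forall>v \<in> verts G. card (open_nbhd G v \<inter> S) \<le> 1)"

definition open_packing_number :: "('a, 'b) pre_digraph \<Rightarrow> nat" where
  "open_packing_number G = Max (card ` {S. open_packing G S})"

definition limited_packing :: "nat \<Rightarrow> ('a, 'b) pre_digraph \<Rightarrow> 'a set \<Rightarrow> bool" where
  "limited_packing k G B \<longleftrightarrow>
     B \<subseteq> verts G \<and> (\<forall>v \<in> verts G. card (closed_nbhd G v \<inter> B) \<le> k)"

definition limited_packing_number :: "nat \<Rightarrow> ('a, 'b) pre_digraph \<Rightarrow> nat" where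
  "limited_packing_number k G = Max (card ` {B. limited_packing k G B})"

end

theory Submission
  imports Defs
begin

text \<open>
  The tree has a centre with \<open>a - 1\<close> further neighbours, where the centre carries
  two leaves and each of its \<open>a - 1\<close> neighbours carries one or two leaves, \<open>b\<close> leaves in total.
  The \<open>a\<close> inner vertices form a total dominating set, which bounds \<open>\<rho>\<^sup>0\<close> and \<open>L\<^sub>1\<close> by \<open>a\<close>; one leaf
  for each inner vertex attains both bounds. All leaves together form a 2-limited packing. Conversely,
  the closed neighbourhood of the centre misses exactly \<open>b - 2\<close> vertices and contains at most 2
  vertices of a 2-limited packing, so \<open>L\<^sub>2\<close> is at most \<open>b\<close>.
\<close>

section \<open>Bounds on packing numbers\<close>

lemma open_packing_number_eqI:
  assumes "finite (verts G)" and "open_packing G S" and "card S = n"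
    and "\<And>S. open_packing G S \<Longrightarrow> card S \<le> n"
  shows "open_packing_number G = n"
proof -
  have "{S. open_packing G S} \<subseteq> Pow (verts G)"
    by (auto simp: open_packing_def)
  then have "finite {S. open_packing G S}"
    using assms(1) by (meson finite_Pow_iff finite_subset)
  then show ?thesis
    unfolding open_packing_number_def using assms(2-4) by (intro Max_eqI) auto
qed

lemma limited_packing_number_eqI:
  assumes "finite (verts G)" and "limited_packing k G B" and "card B = n"
    and "\<And>B. limited_packing k G B \<Longrightarrow> card B \<le> n"
  shows "limited_packing_number k G = n"
proof -
  have "{B. limited_packing k G B} \<subseteq> Pow (verts G)"
    by (auto simp: limited_packing_def)
  then have "finite {B. limited_packing k G B}"
    using assms(1) by (meson finite_Pow_iff finite_subset)
  then show ?thesis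
    unfolding limited_packing_number_def using assms(2-4) by (intro Max_eqI) auto
qed

text \<open>Union bound over the pieces \<open>N v \<inter> S\<close>. The family \<open>N\<close>
  is arbitrary so that open and closed neighbourhoods are handled alike.\<close>

lemma card_le_of_cover:
  assumes "finite D" and "S \<subseteq> (\<Union>v\<in>D. N v)" and "\<And>v. v \<in> D \<Longrightarrow> card (N v \<inter> S) \<le> k"
  shows "card S \<le> k * card D"
proof -
  have "card S = card (\<Union>v\<in>D. N v \<inter> S)"
    using assms(2) by (intro arg_cong[of _ _ card]) auto
  also have "\<dots> \<le> (\<Sum>v\<in>D. card (N v \<inter> S))"
    by (rule card_UN_le[OF assms(1)])
  also have "\<dots> \<le> k * card D"
    using sum_bounded_above[of D "\<lambda>v. card (N v \<inter> S)" k] assms(3) by (simp add: mult.commute)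
  finally show ?thesis .
qed

lemma open_packing_card_le_total_domination:
  assumes "finite D" and "D \<subseteq> verts G" and "verts G \<subseteq> (\<Union>v\<in>D. open_nbhd G v)"
    and "open_packing G S"
  shows "card S \<le> card D"
  using card_le_of_cover[of D S "open_nbhd G" 1] assms by (auto simp: open_packing_def)

lemma limited_packing_card_le_domination:
  assumes "finite D" and "D \<subseteq> verts G" and "verts G \<subseteq> (\<Union>v\<in>D. closed_nbhd G v)"
    and "limited_packing k G B"
  shows "card B \<le> k * card D"
  using card_le_of_cover[of D B "closed_nbhd G" k] assms by (auto simp: limited_packing_def)

section \<open>Trees given by a parent function\<close>

text \<open>Vertex 0 is the root. Both orientations of each edge are arcs, as the encoding of
  undirected graphs demands; the guards against 0 keep \<open>par 0\<close> from creating an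
  arc.\<close>

definition parent_graph :: "nat \<Rightarrow> (nat \<Rightarrow> nat) \<Rightarrow> (nat, nat \<times> nat) pre_digraph" where
  "parent_graph n par =
     \<lparr>verts = {..<n},
      arcs = {(u, v). u < n \<and> v < n \<and> (u \<noteq> 0 \<and> v = par u \<or> v \<noteq> 0 \<and> u = par v)},
      tail = fst, head = snd\<rparr>"

lemma verts_parent_graph [simp]: "verts (parent_graph n par) = {..<n}"
  by (simp add: parent_graph_def)

lemma parent_graph_dominates:
  "u \<rightarrow>\<^bsub>parent_graph n par\<^esub> v \<longleftrightarrow>
     u < n \<and> v < n \<and> (u \<noteq> 0 \<and> v = par u \<or> v \<noteq> 0 \<and> u = par v)"
  by (auto simp: parent_graph_def arcs_ends_conv)

lemma graph_parent_graph:
  assumes "\<And>v. 0 < v \<Longrightarrow> v < n \<Longrightarrow> par v < v"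
  shows "graph (parent_graph n par)"
proof -
  let ?G = "parent_graph n par"
  have "arcs ?G \<subseteq> {..<n} \<times> {..<n}"
    by (auto simp: parent_graph_def)
  then have "finite (arcs ?G)"
    by (rule finite_subset) simp
  then show ?thesis
  proof unfold_locales
    show "symmetric ?G"
      by (auto simp: symmetric_def sym_def parent_graph_dominates)
    show "tail ?G e \<noteq> head ?G e" if "e \<in> arcs ?G" for e
      using that assms[of "fst e"] by (auto simp: parent_graph_def)
  qed (auto simp: parent_graph_def arc_to_ends_def)
qed

text \<open>Parents decrease, so iterating \<open>par\<close> leads every vertex down to 0; symmetry
  lets these walks be reversed and joined at the root.\<close>

lemma connected_parent_graph:
  assumes "\<And>v. 0 < v \<Longrightarrow> v < n \<Longrightarrow> par v < v" and "0 < n"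
  shows "connected (parent_graph n par)"
proof -
  let ?G = "parent_graph n par"
  interpret graph ?G
    using assms(1) by (rule graph_parent_graph)
  have root: "v \<rightarrow>\<^sup>*\<^bsub>?G\<^esub> 0" if "v < n" for v
    using that
  proof (induction v rule: less_induct)
    case (less v)
    show ?case
    proof (cases "v = 0")
      case False
      then have "par v < v"
        using assms(1) less.prems by simp
      moreover from this have "v \<rightarrow>\<^bsub>?G\<^esub> par v"
        using False less.prems by (simp add: parent_graph_dominates)
      ultimately show ?thesis
        using less by (meson adj_reachable_trans order.strict_trans)
    qed (use assms(2) in auto)
  qed
  have "u \<rightarrow>\<^sup>*\<^bsub>?G\<^esub> v" if "u < n" "v < n" for u v
    using root[OF that(1)] root[OF that(2)] symmetric_reachable' reachable_trans by blast
  \<comment> \<open>\<open>connected\<close> refers to the symmetric closure, whose reachability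
    agrees with that of a symmetric digraph.\<close>
  then show ?thesis
    unfolding connected_def strongly_connected_def reachable_mk_symmetric_eq[OF sym_arcs]
    using assms(2) by auto
qed

text \<open>The vertex list of a walk is both its tails followed by the last head and its first tail
  followed by its heads. Comparing entries gives the claim below the last index; closedness gives
  the wrap-around.\<close>

lemma (in pre_digraph) closed_cas_nth:
  assumes "cas u p u" and "i < length p"
  shows "head G (p ! i) = tail G (p ! (Suc i mod length p))"
proof -
  have "p \<noteq> []"
    using assms(2) by auto
  then have eq: "map (tail G) p @ [head G (last p)] = tail G (hd p) # map (head G) p"
    using awalk_verts_conv[of u p] awalk_verts_conv'[OF assms(1)] by simp
  show ?thesis
  proof (cases "Suc i < length p")
    case True
    then show ?thesis
      using arg_cong[OF eq, of "\<lambda>xs. xs ! Suc i"] by (simp add: nth_append)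
  next
    case False
    then have i: "Suc i = length p" and j: "length p - 1 = i"
      using assms(2) by simp_all
    have "awlast u p = u"
      using assms(1) by (induction p arbitrary: u rule: rev_induct) (auto simp: awalk_verts_conv)
    then have "head G (last p) = tail G (hd p)"
      using \<open>p \<noteq> []\<close> assms(1) by (simp add: awalk_verts_conv cas_simp)
    then show ?thesis
      using \<open>p \<noteq> []\<close> by (simp add: i last_conv_nth hd_conv_nth j[unfolded One_nat_def])
  qed
qed

text \<open>
  The largest vertex on a cycle has its parent as both predecessor and successor.
\<close>
lemma parent_graph_no_cycle:
  assumes par: "\<And>v. 0 < v \<Longrightarrow> v < n \<Longrightarrow> par v < v"
    and "pre_digraph.cycle (parent_graph n par) p"
  shows "length p < 3"
proof (rule ccontr)
  let ?G = "parent_graph n par"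
  interpret graph ?G
    using par by (rule graph_parent_graph)
  define l where "l = length p"
  define h where "h i = head ?G (p ! i)" for i
  assume "\<not> length p < 3"
  then have l: "3 \<le> l"
    by (simp add: l_def)
  obtain u where u: "awalk u p u" "distinct (tl (awalk_verts u p))" "p \<noteq> []"
    using assms(2) by (auto simp: cycle_def)
  then have cas: "cas u p u" and "set p \<subseteq> arcs ?G"
    by (auto simp: awalk_def)
  \<comment> \<open>After its first entry the vertex list consists of the heads, so \<open>h\<close>
    enumerates the cycle without repetition.\<close>
  have "distinct (map (head ?G) p)"
    using u awalk_verts_conv'[OF cas] by simp
  then have inj: "i = j" if "h i = h j" "i < l" "j < l" for i j
    using that by (auto simp: h_def l_def distinct_conv_nth)
  have adj: "h i \<rightarrow>\<^bsub>?G\<^esub> h (Suc i mod l)" if "i < l" for i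
  proof -
    have "p ! (Suc i mod l) \<in> set p"
      using u(3) by (simp add: l_def)
    then have "p ! (Suc i mod l) \<in> arcs ?G"
      using \<open>set p \<subseteq> arcs ?G\<close> by blast
    then show ?thesis
      using closed_cas_nth[OF cas, of i] that
      by (intro dominatesI) (simp_all add: h_def l_def arc_to_ends_def)
  qed
  obtain i where i: "i < l" "\<And>j. j < l \<Longrightarrow> h j \<le> h i"
  proof -
    have "Max (h ` {..<l}) \<in> h ` {..<l}"
      using l by (intro Max_in) (auto simp: lessThan_empty_iff)
    then obtain i where "i < l" "h i = Max (h ` {..<l})"
      by auto
    then show thesis
      using that by auto
  qed
  \<comment> \<open>The cyclic predecessor of \<open>i\<close>; the case split avoids truncated
    subtraction at 0.\<close>
  define j where "j = (if i = 0 then l - 1 else i - 1)"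
  have j: "j < l" "Suc j mod l = i"
    using i(1) l by (auto simp: j_def)
  have k: "Suc i mod l < l"
    using l by simp
  \<comment> \<open>The other option, \<open>x = par y\<close>, would force
    \<open>x < y\<close>.\<close>
  have lower: "y = par x" if "x \<rightarrow>\<^bsub>?G\<^esub> y \<or> y \<rightarrow>\<^bsub>?G\<^esub> x" "y \<le> x" for x y
    using that par[of y] by (auto simp: parent_graph_dominates)
  have "h (Suc i mod l) = par (h i)"
    using adj[OF i(1)] i(2)[OF k] by (intro lower) auto
  moreover have "h j = par (h i)"
    using adj[OF j(1)] i(2)[OF j(1)] unfolding j(2) by (intro lower) auto
  ultimately have "j = Suc i mod l"
    using inj j(1) k by simp
  \<comment> \<open>Predecessor and successor of \<open>i\<close> modulo \<open>l\<close> coincide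
    only if \<open>l\<close> divides 2.\<close>
  then show False
    using i(1) l by (simp add: j_def mod_Suc split: if_splits)
qed

lemma undirected_tree_parent_graph:
  assumes "\<And>v. 0 < v \<Longrightarrow> v < n \<Longrightarrow> par v < v" and "0 < n"
  shows "undirected_tree (parent_graph n par)"
  unfolding undirected_tree_def
proof (intro conjI notI; (elim exE conjE)?)
  show "graph (parent_graph n par)"
    using assms(1) by (rule graph_parent_graph)
  show "connected (parent_graph n par)"
    using assms by (rule connected_parent_graph)
  fix p
  assume "pre_digraph.cycle (parent_graph n par) p" and "3 \<le> length p"
  moreover from this(1) have "length p < 3"
    by (rule parent_graph_no_cycle[rotated]) (rule assms(1))
  ultimately show False
    by simp
qed

section \<open>The extremal tree\<close>

text \<open>
  The centre is \<open>0\<close> and its non-leaf neighbours are \<open>1, \<dots>, a - 1\<close>. The vertices from \<open>a\<close> on are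
  leaves, hung cyclically onto the inner vertices.
\<close>
definition packing_tree :: "nat \<Rightarrow> nat \<Rightarrow> (nat, nat \<times> nat) pre_digraph" where
  "packing_tree a b = parent_graph (a + b) (\<lambda>v. if v < a then 0 else v mod a)"

lemma verts_packing_tree [simp]: "verts (packing_tree a b) = {..<a + b}"
  by (simp add: packing_tree_def)

context
  fixes a b :: nat
  assumes a: "2 \<le> a" and ab: "a + 1 \<le> b" and ba: "b \<le> 2 * a"
begin

lemma undirected_tree_packing_tree: "undirected_tree (packing_tree a b)"
  unfolding packing_tree_def
proof (rule undirected_tree_parent_graph)
  fix v :: nat
  assume "0 < v"
  moreover have "v mod a < v" if "a \<le> v"
    using a that mod_less_divisor[of a v] by linarith
  ultimately show "(if v < a then 0 else v mod a) < v"
    by simp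
qed (use a in simp)

lemma packing_tree_inner_nbhd:
  "v < a \<Longrightarrow> v \<noteq> 0 \<Longrightarrow> v \<in> open_nbhd (packing_tree a b) 0"
  "v < a \<Longrightarrow> v \<noteq> 0 \<Longrightarrow> 0 \<in> open_nbhd (packing_tree a b) v"
  using a by (auto simp: open_nbhd_def packing_tree_def parent_graph_dominates)

text \<open>Every parent is below \<open>a\<close>, so a vertex from \<open>a\<close> on is nobody's
  parent and is adjacent to its own parent only.\<close>

lemma packing_tree_leaf_nbhd:
  assumes "a \<le> w"
  shows "w \<in> open_nbhd (packing_tree a b) v \<longleftrightarrow> w < a + b \<and> v = w mod a"
proof -
  have "\<not> a \<le> x mod a" for x
    using a by (simp add: not_le)
  then show ?thesis
    using a assms by (auto simp: open_nbhd_def packing_tree_def parent_graph_dominates)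
qed

lemma packing_tree_total_domination:
  "verts (packing_tree a b) \<subseteq> (\<Union>v<a. open_nbhd (packing_tree a b) v)"
proof
  fix w
  assume w: "w \<in> verts (packing_tree a b)"
  consider "w = 0" | "0 < w" "w < a" | "a \<le> w"
    by linarith
  then show "w \<in> (\<Union>v<a. open_nbhd (packing_tree a b) v)"
  proof cases
    case 1
    \<comment> \<open>The centre needs an inner neighbour; vertex 1 is one because
      \<open>a \<ge> 2\<close>.\<close>
    then show ?thesis
      using packing_tree_inner_nbhd(2)[of 1] a by auto
  next
    case 2
    then show ?thesis
      using packing_tree_inner_nbhd(1)[of w] a by auto
  next
    case 3
    then have "w \<in> open_nbhd (packing_tree a b) (w mod a)"
      using w by (simp add: packing_tree_leaf_nbhd)
    then show ?thesis
      using a by (auto intro!: bexI[of _ "w mod a"])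
  qed
qed

text \<open>The first \<open>a\<close> leaves have distinct residues modulo \<open>a\<close>, hence
  distinct parents, and no two leaves are adjacent. The closed version also yields the open
  one.\<close>

lemma packing_tree_first_leaves_nbhd:
  "card (closed_nbhd (packing_tree a b) v \<inter> {a..<2 * a}) \<le> 1"
proof -
  have "x = y" if "x \<in> closed_nbhd (packing_tree a b) v \<inter> {a..<2 * a}"
    and "y \<in> closed_nbhd (packing_tree a b) v \<inter> {a..<2 * a}" for x y
  proof -
    have "z mod a = z - a" if "z \<in> {a..<2 * a}" for z
      using that by (auto simp: mod_if)
    then show ?thesis
      using that by (auto simp: closed_nbhd_def packing_tree_leaf_nbhd)
  qed
  then show ?thesis
    by (auto simp: card_le_Suc0_iff_eq)
qed

lemma open_packing_number_packing_tree: "open_packing_number (packing_tree a b) = a"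
proof (rule open_packing_number_eqI)
  have "card (open_nbhd (packing_tree a b) v \<inter> {a..<2 * a}) \<le> 1" for v
    using packing_tree_first_leaves_nbhd[of v]
    by (rule order.trans[rotated]) (auto intro: card_mono simp: closed_nbhd_def)
  \<comment> \<open>These leaves all exist since \<open>a < b\<close>.\<close>
  then show "open_packing (packing_tree a b) {a..<2 * a}"
    using ab by (auto simp: open_packing_def)
  show "card S \<le> a" if "open_packing (packing_tree a b) S" for S
    using open_packing_card_le_total_domination[of "{..<a}", OF _ _ packing_tree_total_domination that]
    by auto
qed auto

lemma limited_packing_number_1_packing_tree: "limited_packing_number 1 (packing_tree a b) = a"
proof (rule limited_packing_number_eqI)
  show "limited_packing 1 (packing_tree a b) {a..<2 * a}"
    using packing_tree_first_leaves_nbhd ab by (auto simp: limited_packing_def)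
  have cover: "verts (packing_tree a b) \<subseteq> (\<Union>v<a. closed_nbhd (packing_tree a b) v)"
    using packing_tree_total_domination by (fastforce simp: closed_nbhd_def)
  show "card B \<le> a" if "limited_packing 1 (packing_tree a b) B" for B
    using limited_packing_card_le_domination[of "{..<a}", OF _ _ cover that] by auto
qed auto

lemma limited_packing_2_leaves: "limited_packing 2 (packing_tree a b) {a..<a + b}"
proof -
  have "card (closed_nbhd (packing_tree a b) v \<inter> {a..<a + b}) \<le> 2" for v
  proof (cases "v < a")
    case True
    \<comment> \<open>As \<open>b \<le> 2 * a\<close>, leaves lie below \<open>3 * a\<close>, so the
      quotient by \<open>a\<close> is 1 or 2: at most two leaves per inner vertex.\<close>
    have "w = a + w mod a \<or> w = 2 * a + w mod a" if "w \<in> {a..<a + b}" for w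
    proof -
      have "w div a = 1 \<or> w div a = 2"
        using that ba a div_le_mono[of a w a] less_mult_imp_div_less[of w 3 a] by auto
      then show ?thesis
        using div_mult_mod_eq[of w a] by (metis nat_mult_1)
    qed
    moreover have "w mod a = v" if "w \<in> closed_nbhd (packing_tree a b) v \<inter> {a..<a + b}" for w
      using that True by (auto simp: closed_nbhd_def packing_tree_leaf_nbhd)
    ultimately have "closed_nbhd (packing_tree a b) v \<inter> {a..<a + b} \<subseteq> {a + v, 2 * a + v}"
      by blast
    then have "card (closed_nbhd (packing_tree a b) v \<inter> {a..<a + b}) \<le> card {a + v, 2 * a + v}"
      by (intro card_mono) auto
    also have "\<dots> \<le> 2"
      by (simp add: card_insert_if)
    finally show ?thesis .
  next
    case False
    have "w mod a < a" for w
      using a by simp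
    then have "closed_nbhd (packing_tree a b) v \<inter> {a..<a + b} \<subseteq> {v}"
      using False by (auto simp: closed_nbhd_def packing_tree_leaf_nbhd)
    then have "card (closed_nbhd (packing_tree a b) v \<inter> {a..<a + b}) \<le> card {v}"
      by (intro card_mono) auto
    then show ?thesis
      by simp
  qed
  then show ?thesis
    by (auto simp: limited_packing_def)
qed

lemma limited_packing_number_2_packing_tree: "limited_packing_number 2 (packing_tree a b) = b"
proof (rule limited_packing_number_eqI)
  show "limited_packing 2 (packing_tree a b) {a..<a + b}"
    by (rule limited_packing_2_leaves)
  show "card B \<le> b" if B: "limited_packing 2 (packing_tree a b) B" for B
  proof -
    let ?N = "closed_nbhd (packing_tree a b) 0"
    \<comment> \<open>The leaves not hung on the centre: its own are the multiples \<open>a\<close>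
      and \<open>2 * a\<close>, the latter present because \<open>b \<ge> a + 1\<close>.\<close>
    let ?F = "{a + 1..<2 * a} \<union> {2 * a + 1..<a + b}"
    have sub: "B \<subseteq> {..<a + b}" and N: "card (?N \<inter> B) \<le> 2"
      using B a by (auto simp: limited_packing_def)
    have "w \<in> ?N \<or> w \<in> ?F" if "w < a + b" for w
      using that packing_tree_inner_nbhd(1)[of w] packing_tree_leaf_nbhd[of w 0] a
      by (cases "w < a"; cases "w = a"; cases "w = 2 * a") (auto simp: closed_nbhd_def)
    then have "B \<subseteq> (?N \<inter> B) \<union> ?F"
      using sub by blast
    moreover have "finite B"
      using sub finite_subset by blast
    ultimately have "card B \<le> card ((?N \<inter> B) \<union> ?F)"
      by (intro card_mono) auto
    also have "\<dots> \<le> card (?N \<inter> B) + card ?F"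
      by (rule card_Un_le)
    \<comment> \<open>By \<open>a + 1 \<le> b\<close> no subtraction truncates, so this bound equals
      \<open>b - 2\<close>.\<close>
    also have "card ?F \<le> (a - 1) + (b - a - 1)"
      using card_Un_le[of "{a + 1..<2 * a}" "{2 * a + 1..<a + b}"] by simp
    finally show ?thesis
      using N a ab by linarith
  qed
qed auto

end

theorem theorem5p5:
  fixes a b :: nat
  assumes "a \<ge> 2" and "a + 1 \<le> b" and "b \<le> 2 * a"
  shows "\<exists>T :: (nat, nat \<times> nat) pre_digraph.
           undirected_tree T \<and>
           open_packing_number T = a \<and>
           limited_packing_number 1 T = a \<and>
           limited_packing_number 2 T = b"
  using undirected_tree_packing_tree[OF assms] open_packing_number_packing_tree[OF assms]
    limited_packing_number_1_packing_tree[OF assms] limited_packing_number_2_packing_tree[OF assms]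
  by blast

end
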